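(* Let $G$ be a metabelian group. Then the group $\mathrm{Aut_n}(G)$ of all normal automorphisms of $G$ is soluble of derived length at most $3$.
   Context: An automorphism $\varphi$ of a group $G$ is called normal if $\varphi(H)=H$ for every normal subgroup $H$ of $G$. The normal automorphisms of $G$ form a normal subgroup $\mathrm{Aut_n}(G)$ of the automorphism group $\mathrm{Aut}(G)$. A group is metabelian if it is soluble of derived length at most $2$. Groups are not assumed finite. *)

theory Defs
  imports "HOL-Algebra.Solvable_Groups" "HOL-Algebra.Bij"
begin

text \<open>The value is only meaningful if \<open>solvable G\<close>: otherwise the set under \<open>LEAST\<close> is empty.
  It is therefore always used together with \<open>solvable\<close>.\<close>

definition derived_length :: "('a, 'b) monoid_scheme \<Rightarrow> nat"
  where "derived_length G = (LEAST n. (derived G ^^ n) (carrier G) = {\<one>\<^bsub>G\<^esub>})"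

definition metabelian :: "('a, 'b) monoid_scheme \<Rightarrow> bool"
  where "metabelian G \<longleftrightarrow> solvable G \<and> derived_length G \<le> 2"

definition normal_auto :: "('a, 'b) monoid_scheme \<Rightarrow> ('a \<Rightarrow> 'a) set"
  where "normal_auto G = {\<phi> \<in> auto G. \<forall>H. H \<lhd> G \<longrightarrow> \<phi> ` H = H}"

definition NormalAutoGroup :: "('a, 'b) monoid_scheme \<Rightarrow> ('a \<Rightarrow> 'a) monoid"
  where "NormalAutoGroup G = AutoGroup G \<lparr>carrier := normal_auto G\<rparr>"

lemma (in group) solvable_derived_length_le_iff:
  "solvable G \<and> derived_length G \<le> n \<longleftrightarrow> (derived G ^^ n) (carrier G) = {\<one>}"
proof
  assume *: "solvable G \<and> derived_length G \<le> n"
  let ?d = "derived_length G"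
  obtain m where "(derived G ^^ m) (carrier G) = {\<one>}"
    using * solvable_iff_trivial_derived_seq by blast
  hence d: "(derived G ^^ ?d) (carrier G) = {\<one>}"
    unfolding derived_length_def by (rule LeastI)
  have triv: "(derived G ^^ k) {\<one>} = {\<one>}" for k
  proof
    show "(derived G ^^ k) {\<one>} \<subseteq> {\<one>}"
      by (induction k) (use derived_incl[OF _ triv_subgroup] in auto)
    show "{\<one>} \<subseteq> (derived G ^^ k) {\<one>}"
      using subgroup.one_closed[OF exp_of_derived_is_subgroup[OF triv_subgroup]] by simp
  qed
  have "(derived G ^^ n) (carrier G) = (derived G ^^ (n - ?d)) ((derived G ^^ ?d) (carrier G))"
    using * by (metis comp_apply funpow_add le_add_diff_inverse2)
  thus "(derived G ^^ n) (carrier G) = {\<one>}"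
    using d triv by simp
next
  assume "(derived G ^^ n) (carrier G) = {\<one>}"
  thus "solvable G \<and> derived_length G \<le> n"
    unfolding derived_length_def using solvable_iff_trivial_derived_seq by (auto intro: Least_le)
qed

lemma (in group) auto_image_normal:
  assumes "\<phi> \<in> auto G" "H \<lhd> G"
  shows "\<phi> ` H \<lhd> G"
proof -
  interpret H: normal H G by fact
  have hom: "\<phi> \<in> hom G G" and surj: "\<phi> ` carrier G = carrier G"
    using assms(1) by (auto simp: auto_def Bij_def bij_betw_def)
  interpret \<phi>: group_hom G G \<phi>
    by (intro group_hom.intro group_hom_axioms.intro is_group hom)
  have "subgroup (\<phi> ` H) G"
    by (rule \<phi>.subgroup_img_is_subgroup) (rule H.is_subgroup)
  moreover have "x \<otimes> h \<otimes> inv x \<in> \<phi> ` H" if "x \<in> carrier G" "h \<in> \<phi> ` H" for x h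
  proof -
    have "x \<in> \<phi> ` carrier G"
      using that(1) surj by simp
    then obtain y where y: "y \<in> carrier G" "x = \<phi> y"
      by (rule imageE)
    from that(2) obtain k where k: "k \<in> H" "h = \<phi> k"
      by (rule imageE)
    have "y \<otimes> k \<otimes> inv y \<in> H"
      using H.inv_op_closed2 y(1) k(1) by simp
    moreover have "x \<otimes> h \<otimes> inv x = \<phi> (y \<otimes> k \<otimes> inv y)"
      unfolding y(2) k(2) using y(1) H.mem_carrier[OF k(1)] by simp
    ultimately show ?thesis
      by (simp only: imageI)
  qed
  ultimately show ?thesis
    by (simp add: normal_inv_iff)
qed

lemma mult_AutoGroup:
  assumes "f \<in> auto G" "g \<in> auto G"
  shows "f \<otimes>\<^bsub>AutoGroup G\<^esub> g = compose (carrier G) f g"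
  using assms by (simp add: AutoGroup_def BijGroup_def auto_def)

lemma (in group) inv_AutoGroup:
  assumes "f \<in> auto G"
  shows "inv\<^bsub>AutoGroup G\<^esub> f = (\<lambda>x\<in>carrier G. inv_into (carrier G) f x)"
  using assms group.m_inv_consistent[OF group_BijGroup subgroup_auto assms]
  by (simp add: AutoGroup_def inv_BijGroup auto_def)

lemma (in group) subgroup_normal_auto: "subgroup (normal_auto G) (AutoGroup G)"
proof -
  interpret A: group "AutoGroup G" by (rule AutoGroup)
  have carr: "carrier (AutoGroup G) = auto G"
    by (simp add: AutoGroup_def)
  have sub: "H \<subseteq> carrier G" if "H \<lhd> G" for H
    using that normal_imp_subgroup subgroup.subset by blast
  show ?thesis
  proof (rule A.subgroupI)
    show "normal_auto G \<subseteq> carrier (AutoGroup G)"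
      by (auto simp: normal_auto_def carr)
    have "(\<lambda>x\<in>carrier G. x) ` H = H" if "H \<lhd> G" for H
    proof -
      have "(\<lambda>x\<in>carrier G. x) ` H = (\<lambda>x. x) ` H"
        using sub[OF that] by (intro image_cong) auto
      thus ?thesis by simp
    qed
    hence "(\<lambda>x\<in>carrier G. x) \<in> normal_auto G"
      using id_in_auto by (simp add: normal_auto_def)
    thus "normal_auto G \<noteq> {}" by blast
  next
    fix f assume f: "f \<in> normal_auto G"
    hence fa: "f \<in> auto G" by (simp add: normal_auto_def)
    have inj: "inj_on f (carrier G)"
      using fa by (simp add: auto_def Bij_def bij_betw_def)
    have "(inv\<^bsub>AutoGroup G\<^esub> f) ` H = H" if H: "H \<lhd> G" for H
    proof -
      have "(inv\<^bsub>AutoGroup G\<^esub> f) ` H = inv_into (carrier G) f ` f ` H"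
        using sub[OF H] f H by (auto simp: inv_AutoGroup[OF fa] normal_auto_def intro!: image_cong)
      also have "\<dots> = H"
        using inj sub[OF H] by (simp add: inv_into_image_cancel)
      finally show ?thesis .
    qed
    thus "inv\<^bsub>AutoGroup G\<^esub> f \<in> normal_auto G"
      using A.inv_closed fa by (simp add: normal_auto_def carr)
  next
    fix f g assume fg: "f \<in> normal_auto G" "g \<in> normal_auto G"
    hence a: "f \<in> auto G" "g \<in> auto G" by (simp_all add: normal_auto_def)
    have "(f \<otimes>\<^bsub>AutoGroup G\<^esub> g) ` H = H" if H: "H \<lhd> G" for H
    proof -
      have "(f \<otimes>\<^bsub>AutoGroup G\<^esub> g) ` H = f ` g ` H"
        using sub[OF H] unfolding mult_AutoGroup[OF a] compose_def image_image
        by (intro image_cong) auto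
      thus ?thesis using fg H by (simp add: normal_auto_def)
    qed
    thus "f \<otimes>\<^bsub>AutoGroup G\<^esub> g \<in> normal_auto G"
      using A.m_closed a by (simp add: normal_auto_def carr)
  qed
qed

lemma (in group) group_NormalAutoGroup: "group (NormalAutoGroup G)"
  unfolding NormalAutoGroup_def
  by (rule subgroup.subgroup_is_group[OF subgroup_normal_auto AutoGroup])

lemma (in group) normal_auto_normal: "normal_auto G \<lhd> AutoGroup G"
proof -
  interpret A: group "AutoGroup G" by (rule AutoGroup)
  have carr: "carrier (AutoGroup G) = auto G"
    by (simp add: AutoGroup_def)
  have sub: "H \<subseteq> carrier G" if "H \<lhd> G" for H
    using that normal_imp_subgroup subgroup.subset by blast
  have "g \<otimes>\<^bsub>AutoGroup G\<^esub> f \<otimes>\<^bsub>AutoGroup G\<^esub> inv\<^bsub>AutoGroup G\<^esub> g \<in> normal_auto G"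
    if g: "g \<in> auto G" and f: "f \<in> normal_auto G" for f g
  proof -
    let ?i = "inv\<^bsub>AutoGroup G\<^esub> g"
    have fa: "f \<in> auto G" using f by (simp add: normal_auto_def)
    have ia: "?i \<in> auto G" using A.inv_closed g carr by simp
    have gf: "g \<otimes>\<^bsub>AutoGroup G\<^esub> f \<in> auto G" using A.m_closed g fa carr by simp
    have "(g \<otimes>\<^bsub>AutoGroup G\<^esub> f \<otimes>\<^bsub>AutoGroup G\<^esub> ?i) ` H = H" if H: "H \<lhd> G" for H
    proof -
      have iH: "?i ` H \<lhd> G" by (rule auto_image_normal[OF ia H])
      have "(g \<otimes>\<^bsub>AutoGroup G\<^esub> f \<otimes>\<^bsub>AutoGroup G\<^esub> ?i) ` H = (g \<otimes>\<^bsub>AutoGroup G\<^esub> f) ` ?i ` H"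
        using sub[OF H] unfolding mult_AutoGroup[OF gf ia] compose_def image_image
        by (intro image_cong) auto
      also have "\<dots> = g ` f ` ?i ` H"
        using sub[OF iH] unfolding mult_AutoGroup[OF g fa] compose_def image_image[of g f]
        by (intro image_cong) auto
      also have "\<dots> = g ` ?i ` H"
        using f iH by (simp add: normal_auto_def)
      also have "\<dots> = g ` inv_into (carrier G) g ` H"
        using sub[OF H] unfolding inv_AutoGroup[OF g]
        by (intro arg_cong[where f = "image g"] image_cong) auto
      also have "\<dots> = H"
        using g sub[OF H] by (intro image_inv_into_cancel) (auto simp: auto_def Bij_def bij_betw_def)
      finally show ?thesis .
    qed
    thus ?thesis
      using A.m_closed gf ia by (simp add: normal_auto_def carr)
  qed
  thus ?thesis
    using subgroup_normal_auto by (simp add: A.normal_inv_iff carr)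
qed

end

theory Submission
  imports Defs
begin

text \<open>
  Write \<open>A = G'\<close>. Both \<open>A\<close> and \<open>G/A\<close> are abelian, and the derived series of the group of normal
  automorphisms is pushed down the series \<open>G \<ge> A \<ge> 1\<close> in three steps. Each step shows that certain
  normal automorphisms commute on a section \<open>X/N\<close>; their commutators are then trivial on that
  section (lemma \<open>derived_subset_section_stabilizer\<close>).

  On \<open>G/A\<close> every subgroup is normal, so a normal automorphism sends every element to one of its
  powers; any two maps with this property that are homomorphisms commute. Hence commutators of
  normal automorphisms act trivially on \<open>G/A\<close>.

  Let \<open>f\<close> be a normal automorphism that is trivial on \<open>G/A\<close>. As \<open>A\<close> is abelian, \<open>f\<close> is
  linear on \<open>A\<close> over the commutative ring \<open>\<int>[G/A]\<close>. For \<open>a \<in> A\<close> the normal closure of \<open>a\<close> is the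
  cyclic submodule \<open>\<int>[G/A] a\<close>, so \<open>f a = r a\<close> for some scalar \<open>r\<close>. If \<open>g\<close> is another such
  automorphism and \<open>g a = s a\<close>, then \<open>f (g a) = s r a = r s a = g (f a)\<close>, so \<open>f\<close> and \<open>g\<close> commute
  on \<open>A\<close>. This is the first step again, with \<open>\<int>[G/A]\<close> in place of \<open>\<int>\<close>.

  Finally, if \<open>f\<close> and \<open>g\<close> are trivial on both \<open>G/A\<close> and \<open>A\<close>, then \<open>f x = d x\<close> and \<open>g x = e x\<close>
  with \<open>d, e \<in> A\<close> fixed by both maps, and \<open>f (g x) = e d x = d e x = g (f x)\<close>. So the
  automorphisms that remain after two steps commute, and the third derived subgroup is trivial.
\<close>

section \<open>Normal automorphisms as maps\<close>

context group
begin

lemma normal_auto_hom: "f \<in> normal_auto G \<Longrightarrow> f \<in> hom G G"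
  by (simp add: normal_auto_def auto_def)

lemma normal_auto_group_hom: "f \<in> normal_auto G \<Longrightarrow> group_hom G G f"
  by (intro group_hom.intro group_hom_axioms.intro is_group normal_auto_hom)

lemma normal_auto_image: "f \<in> normal_auto G \<Longrightarrow> H \<lhd> G \<Longrightarrow> f ` H = H"
  by (simp add: normal_auto_def)

lemma normal_auto_mem: "f \<in> normal_auto G \<Longrightarrow> H \<lhd> G \<Longrightarrow> x \<in> H \<Longrightarrow> f x \<in> H"
  using normal_auto_image by blast

lemma normal_auto_closed: "f \<in> normal_auto G \<Longrightarrow> x \<in> carrier G \<Longrightarrow> f x \<in> carrier G"
  using normal_auto_mem[OF _ normal_self] .

lemma carrier_NormalAutoGroup: "carrier (NormalAutoGroup G) = normal_auto G"
  by (simp add: NormalAutoGroup_def)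

lemma mult_NormalAutoGroup_apply:
  assumes "f \<in> normal_auto G" "g \<in> normal_auto G" "x \<in> carrier G"
  shows "(f \<otimes>\<^bsub>NormalAutoGroup G\<^esub> g) x = f (g x)"
proof -
  have "f \<otimes>\<^bsub>NormalAutoGroup G\<^esub> g = compose (carrier G) f g"
    using assms mult_AutoGroup[of f G g] by (simp add: NormalAutoGroup_def normal_auto_def)
  thus ?thesis using assms(3) by (simp add: compose_eq)
qed

lemma one_NormalAutoGroup: "\<one>\<^bsub>NormalAutoGroup G\<^esub> = (\<lambda>x\<in>carrier G. x)"
  by (simp add: NormalAutoGroup_def AutoGroup_def BijGroup_def)

lemma inv_NormalAutoGroup_cancel:
  assumes f: "f \<in> normal_auto G" and x: "x \<in> carrier G"
  shows "f ((inv\<^bsub>NormalAutoGroup G\<^esub> f) x) = x"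
proof -
  interpret N: group "NormalAutoGroup G" by (rule group_NormalAutoGroup)
  have fN: "f \<in> carrier (NormalAutoGroup G)" using f by (simp add: carrier_NormalAutoGroup)
  have i: "inv\<^bsub>NormalAutoGroup G\<^esub> f \<in> normal_auto G"
    using N.inv_closed[OF fN] by (simp add: carrier_NormalAutoGroup)
  show ?thesis
    using mult_NormalAutoGroup_apply[OF f i x] N.r_inv[OF fN] x by (simp add: one_NormalAutoGroup)
qed

section \<open>Automorphisms that are trivial on a section\<close>

definition section_stabilizer :: "'a set \<Rightarrow> 'a set \<Rightarrow> ('a \<Rightarrow> 'a) set"
  where "section_stabilizer X N = {f \<in> normal_auto G. \<forall>x\<in>X. N #> f x = N #> x}"

text \<open>A normal automorphism maps \<open>N\<close> onto itself, so it acts on the cosets of \<open>N\<close>.\<close>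

lemma normal_auto_coset_cong:
  assumes N: "N \<lhd> G" and f: "f \<in> normal_auto G"
    and u: "u \<in> carrier G" and v: "v \<in> carrier G" and eq: "N #> u = N #> v"
  shows "N #> f u = N #> f v"
proof -
  interpret f: group_hom G G f by (rule normal_auto_group_hom[OF f])
  have sub: "subgroup N G" by (rule normal_imp_subgroup[OF N])
  have "u \<in> N #> v" using eq rcos_self[OF u sub] by simp
  then obtain n where n: "n \<in> N" "u = n \<otimes> v" by (auto simp: r_coset_def)
  have "f u = f n \<otimes> f v" using n v subgroup.mem_carrier[OF sub] by simp
  hence "f u \<in> N #> f v" using normal_auto_mem[OF f N n(1)] by (auto simp: r_coset_def)
  thus ?thesis using repr_independence[OF _ _ sub] f.hom_closed[OF v] by metis
qed

lemma subgroup_section_stabilizer: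
  assumes X: "X \<lhd> G" and N: "N \<lhd> G"
  shows "subgroup (section_stabilizer X N) (NormalAutoGroup G)"
proof -
  interpret A: group "NormalAutoGroup G" by (rule group_NormalAutoGroup)
  have XG: "x \<in> carrier G" if "x \<in> X" for x
    using subgroup.mem_carrier[OF normal_imp_subgroup[OF X]] that .
  show ?thesis
  proof (rule A.subgroupI)
    show "section_stabilizer X N \<subseteq> carrier (NormalAutoGroup G)"
      by (auto simp: section_stabilizer_def carrier_NormalAutoGroup)
    have "\<one>\<^bsub>NormalAutoGroup G\<^esub> \<in> section_stabilizer X N"
      using A.one_closed XG
      by (simp add: section_stabilizer_def carrier_NormalAutoGroup one_NormalAutoGroup)
    thus "section_stabilizer X N \<noteq> {}" by blast
  next
    fix f assume "f \<in> section_stabilizer X N"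
    hence f: "f \<in> normal_auto G" and fx: "\<And>x. x \<in> X \<Longrightarrow> N #> f x = N #> x"
      by (auto simp: section_stabilizer_def)
    let ?i = "inv\<^bsub>NormalAutoGroup G\<^esub> f"
    have i: "?i \<in> normal_auto G"
      using A.inv_closed f by (simp add: carrier_NormalAutoGroup)
    have "N #> ?i x = N #> x" if x: "x \<in> X" for x
      using fx[OF normal_auto_mem[OF i X x]] inv_NormalAutoGroup_cancel[OF f XG[OF x]] by simp
    thus "?i \<in> section_stabilizer X N" using i by (simp add: section_stabilizer_def)
  next
    fix f g assume "f \<in> section_stabilizer X N" "g \<in> section_stabilizer X N"
    hence f: "f \<in> normal_auto G" and fx: "\<And>x. x \<in> X \<Longrightarrow> N #> f x = N #> x"
      and g: "g \<in> normal_auto G" and gx: "\<And>x. x \<in> X \<Longrightarrow> N #> g x = N #> x"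
      by (auto simp: section_stabilizer_def)
    have "f \<otimes>\<^bsub>NormalAutoGroup G\<^esub> g \<in> normal_auto G"
      using A.m_closed f g by (simp add: carrier_NormalAutoGroup)
    moreover have "N #> f (g x) = N #> x" if "x \<in> X" for x
      using fx[OF normal_auto_mem[OF g X that]] gx[OF that] by simp
    ultimately show "f \<otimes>\<^bsub>NormalAutoGroup G\<^esub> g \<in> section_stabilizer X N"
      using f g XG by (simp add: section_stabilizer_def mult_NormalAutoGroup_apply)
  qed
qed

text \<open>The commutator \<open>c = [f, g]\<close> maps \<open>g (f x)\<close> to \<open>f (g x)\<close>, and every element of \<open>X\<close> has the
  form \<open>g (f x)\<close> because normal automorphisms map \<open>X\<close> onto itself.\<close>

lemma derived_subset_section_stabilizer:
  assumes X: "X \<lhd> G" and N: "N \<lhd> G" and S: "S \<subseteq> normal_auto G"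
    and comm: "\<And>f g x. f \<in> S \<Longrightarrow> g \<in> S \<Longrightarrow> x \<in> X \<Longrightarrow> N #> f (g x) = N #> g (f x)"
  shows "derived (NormalAutoGroup G) S \<subseteq> section_stabilizer X N"
  unfolding derived_def
proof (rule group.generate_subgroup_incl[OF group_NormalAutoGroup _ subgroup_section_stabilizer[OF X N]])
  interpret A: group "NormalAutoGroup G" by (rule group_NormalAutoGroup)
  have XG: "x \<in> carrier G" if "x \<in> X" for x
    using subgroup.mem_carrier[OF normal_imp_subgroup[OF X]] that .
  show "derived_set (NormalAutoGroup G) S \<subseteq> section_stabilizer X N"
  proof clarify
    fix f g assume fg: "f \<in> S" "g \<in> S"
    hence f: "f \<in> normal_auto G" and g: "g \<in> normal_auto G" using S by auto
    note fN = f[folded carrier_NormalAutoGroup] and gN = g[folded carrier_NormalAutoGroup]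
    let ?c = "f \<otimes>\<^bsub>NormalAutoGroup G\<^esub> g \<otimes>\<^bsub>NormalAutoGroup G\<^esub> inv\<^bsub>NormalAutoGroup G\<^esub> f
      \<otimes>\<^bsub>NormalAutoGroup G\<^esub> inv\<^bsub>NormalAutoGroup G\<^esub> g"
    have c: "?c \<in> normal_auto G"
      using fN gN unfolding carrier_NormalAutoGroup[symmetric] by simp
    have cgf: "?c \<otimes>\<^bsub>NormalAutoGroup G\<^esub> (g \<otimes>\<^bsub>NormalAutoGroup G\<^esub> f) = f \<otimes>\<^bsub>NormalAutoGroup G\<^esub> g"
      using fN gN by (simp add: A.m_assoc A.inv_solve_right' flip: A.inv_mult_group)
    have gf: "g \<otimes>\<^bsub>NormalAutoGroup G\<^esub> f \<in> normal_auto G"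
      using fN gN unfolding carrier_NormalAutoGroup[symmetric] by simp
    have "N #> ?c y = N #> y" if y: "y \<in> X" for y
    proof -
      have "y \<in> g ` f ` X" using y normal_auto_image[OF f X] normal_auto_image[OF g X] by simp
      then obtain x where x: "x \<in> X" "y = g (f x)" by blast
      have "?c y = f (g x)"
        using arg_cong[OF cgf, of "\<lambda>h. h x"] x(2) XG[OF x(1)] f g
          mult_NormalAutoGroup_apply[OF c gf XG[OF x(1)]]
        by (simp add: mult_NormalAutoGroup_apply)
      thus ?thesis using comm[OF fg x(1)] x(2) by simp
    qed
    thus "?c \<in> section_stabilizer X N" using c by (simp add: section_stabilizer_def)
  qed
qed

lemma trivial_coset: "x \<in> carrier G \<Longrightarrow> {\<one>} #> x = {x}"
  by (auto simp: r_coset_def)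

lemma section_stabilizer_carrier_trivial:
  "section_stabilizer (carrier G) {\<one>} \<subseteq> {\<one>\<^bsub>NormalAutoGroup G\<^esub>}"
proof clarify
  fix f assume "f \<in> section_stabilizer (carrier G) {\<one>}"
  hence f: "f \<in> normal_auto G" and fx: "\<And>x. x \<in> carrier G \<Longrightarrow> {\<one>} #> f x = {\<one>} #> x"
    by (auto simp: section_stabilizer_def)
  show "f = \<one>\<^bsub>NormalAutoGroup G\<^esub>"
    unfolding one_NormalAutoGroup
  proof (rule extensionalityI)
    show "f \<in> extensional (carrier G)"
      using f by (simp add: normal_auto_def auto_def Bij_def)
    show "f x = (\<lambda>x\<in>carrier G. x) x" if "x \<in> carrier G" for x
      using fx[OF that] that normal_auto_closed[OF f that] by (simp add: trivial_coset)
  qed simp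
qed

end

section \<open>Extensions of an abelian group by an abelian group\<close>

locale abelian_by_abelian = normal A G for A and G (structure) +
  assumes kernel_comm: "\<lbrakk>a \<in> A; b \<in> A\<rbrakk> \<Longrightarrow> a \<otimes> b = b \<otimes> a"
    and quotient_comm: "\<lbrakk>x \<in> carrier G; y \<in> carrier G\<rbrakk> \<Longrightarrow> A #> (x \<otimes> y) = A #> (y \<otimes> x)"
begin

lemma A_normal: "A \<lhd> G"
  by (rule normal_axioms)

lemma coset_mult_cong:
  assumes "A #> x = A #> x'" "A #> y = A #> y'"
    and "x \<in> carrier G" "x' \<in> carrier G" "y \<in> carrier G" "y' \<in> carrier G"
  shows "A #> (x \<otimes> y) = A #> (x' \<otimes> y')"
  using assms rcos_sum by metis

lemma coset_int_pow_cong: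
  assumes "A #> x = A #> y" "x \<in> carrier G" "y \<in> carrier G"
  shows "A #> (x [^] (n::int)) = A #> (y [^] n)"
proof -
  interpret p: group_hom G "G Mod A" "\<lambda>x. A #> x"
    by (intro group_hom.intro group_hom_axioms.intro is_group factorgroup_is_group r_coset_hom_Mod)
  show ?thesis using p.hom_int_pow assms by metis
qed

lemma coset_eq_imp_mult:
  assumes "A #> y = A #> x" "x \<in> carrier G" "y \<in> carrier G"
  shows "\<exists>a\<in>A. y = a \<otimes> x"
  using assms rcos_self[OF assms(3) is_subgroup] by (auto simp: r_coset_def)

subsection \<open>Power automorphisms of the quotient\<close>

text \<open>The elements that are powers of \<open>x\<close> modulo \<open>A\<close> form a normal subgroup, because \<open>G/A\<close> is
  abelian; a normal automorphism keeps \<open>x\<close> inside it.\<close>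

lemma normal_auto_power_mod:
  assumes f: "f \<in> normal_auto G" and x: "x \<in> carrier G"
  shows "\<exists>n::int. A #> f x = A #> (x [^] n)"
proof -
  let ?B = "{y \<in> carrier G. \<exists>n::int. A #> y = A #> (x [^] n)}"
  have "subgroup ?B G"
  proof (rule subgroupI)
    show "?B \<noteq> {}" using x by (auto intro!: exI[of _ x] exI[of _ "1::int"])
  next
    fix y assume "y \<in> ?B"
    then obtain n :: int where y: "y \<in> carrier G" "A #> y = A #> (x [^] n)" by blast
    have "A #> inv y = A #> (x [^] (- n))"
      using coset_int_pow_cong[OF y(2) y(1), of "-1"] x y(1) by (simp add: int_pow_neg int_pow_pow)
    thus "inv y \<in> ?B" using y(1) by blast
  next
    fix y z assume "y \<in> ?B" "z \<in> ?B"
    then obtain n m :: int where y: "y \<in> carrier G" "A #> y = A #> (x [^] n)"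
      and z: "z \<in> carrier G" "A #> z = A #> (x [^] m)" by blast
    have "A #> (y \<otimes> z) = A #> (x [^] (n + m))"
      using coset_mult_cong[OF y(2) z(2)] y(1) z(1) x by (simp add: int_pow_mult)
    thus "y \<otimes> z \<in> ?B" using y(1) z(1) by blast
  qed blast
  moreover have "g \<otimes> y \<otimes> inv g \<in> ?B" if g: "g \<in> carrier G" and y: "y \<in> ?B" for g y
  proof -
    have yG: "y \<in> carrier G" using y by blast
    have "A #> (g \<otimes> y \<otimes> inv g) = A #> (y \<otimes> g \<otimes> inv g)"
      using g yG by (intro coset_mult_cong quotient_comm refl m_closed inv_closed)
    also have "y \<otimes> g \<otimes> inv g = y" using g yG by (simp add: m_assoc)
    finally show ?thesis using g y by auto
  qed
  ultimately have "?B \<lhd> G" by (simp add: normal_inv_iff)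
  moreover have "x \<in> ?B" using x by (auto intro!: exI[of _ "1::int"])
  ultimately have "f x \<in> ?B" using normal_auto_mem[OF f] by blast
  thus ?thesis by blast
qed

text \<open>Modulo \<open>A\<close>, if \<open>f x\<close> is the \<open>n\<close>-th power of \<open>x\<close> and \<open>g x\<close> the \<open>m\<close>-th power, then
  \<open>f (g x)\<close> and \<open>g (f x)\<close> are both the \<open>n m\<close>-th power. The exponents need to be
  known for this one \<open>x\<close> only.\<close>

lemma normal_autos_commute_mod:
  assumes f: "f \<in> normal_auto G" and g: "g \<in> normal_auto G" and x: "x \<in> carrier G"
  shows "A #> f (g x) = A #> g (f x)"
proof -
  obtain n :: int where n: "A #> f x = A #> (x [^] n)" using normal_auto_power_mod[OF f x] by blast
  obtain m :: int where m: "A #> g x = A #> (x [^] m)" using normal_auto_power_mod[OF g x] by blast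
  have *: "A #> u (v x) = A #> (x [^] (k * l))"
    if u: "u \<in> normal_auto G" and v: "v \<in> normal_auto G"
      and k: "A #> u x = A #> (x [^] k)" and l: "A #> v x = A #> (x [^] l)"
    for u v and k l :: int
  proof -
    interpret u: group_hom G G u by (rule normal_auto_group_hom[OF u])
    have "A #> u (v x) = A #> u (x [^] l)"
      using x v l by (intro normal_auto_coset_cong[OF A_normal u]) (auto intro: normal_auto_closed)
    also have "\<dots> = A #> (u x [^] l)" using x by (simp add: u.hom_int_pow)
    also have "\<dots> = A #> ((x [^] k) [^] l)" using x by (intro coset_int_pow_cong[OF k]) auto
    also have "\<dots> = A #> (x [^] (k * l))" using x by (simp add: int_pow_pow)
    finally show ?thesis .
  qed
  show ?thesis using *[OF f g n m] *[OF g f m n] by (simp add: mult.commute)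
qed

subsection \<open>Equivariant endomorphisms of the kernel\<close>

definition conj :: "'a \<Rightarrow> 'a \<Rightarrow> 'a"
  where "conj g x = g \<otimes> x \<otimes> inv g"

lemma conj_mem: "g \<in> carrier G \<Longrightarrow> a \<in> A \<Longrightarrow> conj g a \<in> A"
  unfolding conj_def by (rule inv_op_closed2)

lemma conj_mult:
  "g \<in> carrier G \<Longrightarrow> x \<in> carrier G \<Longrightarrow> y \<in> carrier G \<Longrightarrow> conj g (x \<otimes> y) = conj g x \<otimes> conj g y"
  by (simp add: conj_def m_assoc) (simp flip: m_assoc)

lemma conj_conj:
  "g \<in> carrier G \<Longrightarrow> h \<in> carrier G \<Longrightarrow> x \<in> carrier G \<Longrightarrow> conj g (conj h x) = conj (g \<otimes> h) x"
  by (simp add: conj_def m_assoc inv_mult_group)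

text \<open>As \<open>A\<close> is abelian, the conjugation action on \<open>A\<close> factors through \<open>G/A\<close>.\<close>

lemma conj_coset_cong:
  assumes eq: "A #> g = A #> h" and g: "g \<in> carrier G" and h: "h \<in> carrier G" and a: "a \<in> A"
  shows "conj g a = conj h a"
proof -
  obtain b where b: "b \<in> A" "g = b \<otimes> h" using coset_eq_imp_mult[OF eq h g] by blast
  have bG: "b \<in> carrier G" and aG: "a \<in> carrier G" using a b by auto
  have "conj g a = b \<otimes> conj h a \<otimes> inv b"
    using conj_conj[OF bG h aG] b(2) by (simp add: conj_def[of b])
  also have "b \<otimes> conj h a = conj h a \<otimes> b" by (rule kernel_comm[OF b(1) conj_mem[OF h a]])
  finally show ?thesis using bG conj_mem[OF h a] by (simp add: m_assoc)
qed

text \<open>So the conjugations commute on \<open>A\<close>, which makes each of them \<open>\<int>[G/A]\<close>-linear there.\<close>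

lemma conj_commute:
  assumes "g \<in> carrier G" "h \<in> carrier G" "a \<in> A"
  shows "conj g (conj h a) = conj h (conj g a)"
  using conj_coset_cong[OF quotient_comm[OF assms(1,2)]] assms by (simp add: conj_conj)

text \<open>The endomorphisms of \<open>A\<close> as a module over \<open>\<int>[G/A]\<close>.\<close>

definition equivariant_endo :: "('a \<Rightarrow> 'a) set"
  where "equivariant_endo = {r \<in> A \<rightarrow> A.
    (\<forall>x\<in>A. \<forall>y\<in>A. r (x \<otimes> y) = r x \<otimes> r y) \<and>
    (\<forall>g\<in>carrier G. \<forall>x\<in>A. r (conj g x) = conj g (r x))}"

text \<open>The centre of this endomorphism ring contains the action of \<open>\<int>[G/A]\<close>. It stands in for
  the group ring: its elements are the scalars, and their values at a point fill a normal subgroup.\<close>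

definition scalar :: "('a \<Rightarrow> 'a) set"
  where "scalar = {r \<in> equivariant_endo. \<forall>q\<in>equivariant_endo. \<forall>x\<in>A. r (q x) = q (r x)}"

lemma equivariant_endoD:
  assumes "r \<in> equivariant_endo"
  shows "x \<in> A \<Longrightarrow> r x \<in> A"
    and "x \<in> A \<Longrightarrow> y \<in> A \<Longrightarrow> r (x \<otimes> y) = r x \<otimes> r y"
    and "g \<in> carrier G \<Longrightarrow> x \<in> A \<Longrightarrow> r (conj g x) = conj g (r x)"
  using assms by (auto simp: equivariant_endo_def)

lemma equivariant_endo_inv:
  assumes r: "r \<in> equivariant_endo" and x: "x \<in> A"
  shows "r (inv x) = inv (r x)"
proof -
  have "r \<one> \<otimes> r \<one> = r \<one>" using equivariant_endoD(2)[OF r, of \<one> \<one>] by simp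
  hence "r \<one> = \<one>" using equivariant_endoD(1)[OF r subgroup.one_closed[OF is_subgroup]] by simp
  hence "r (inv x) \<otimes> r x = \<one>"
    using equivariant_endoD(2)[OF r, of "inv x" x] x by simp
  thus ?thesis using equivariant_endoD(1)[OF r] x by (intro inv_equality[symmetric]) auto
qed

lemma scalar_equivariant: "r \<in> scalar \<Longrightarrow> r \<in> equivariant_endo"
  by (simp add: scalar_def)

lemma scalar_central: "r \<in> scalar \<Longrightarrow> q \<in> equivariant_endo \<Longrightarrow> x \<in> A \<Longrightarrow> r (q x) = q (r x)"
  by (simp add: scalar_def)

lemma id_scalar: "(\<lambda>x. x) \<in> scalar"
  by (auto simp: scalar_def equivariant_endo_def)

lemma kernel_mult_swap:
  assumes "a \<in> A" "b \<in> A" "c \<in> A" "d \<in> A"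
  shows "(a \<otimes> b) \<otimes> (c \<otimes> d) = (a \<otimes> c) \<otimes> (b \<otimes> d)"
proof -
  have "(a \<otimes> b) \<otimes> (c \<otimes> d) = a \<otimes> ((b \<otimes> c) \<otimes> d)" using assms by (simp add: m_assoc)
  also have "b \<otimes> c = c \<otimes> b" using assms by (intro kernel_comm)
  also have "a \<otimes> ((c \<otimes> b) \<otimes> d) = (a \<otimes> c) \<otimes> (b \<otimes> d)" using assms by (simp add: m_assoc)
  finally show ?thesis .
qed

lemma mult_scalar:
  assumes r: "r \<in> scalar" and s: "s \<in> scalar"
  shows "(\<lambda>x. r x \<otimes> s x) \<in> scalar"
proof -
  note r' = equivariant_endoD[OF scalar_equivariant[OF r]]
    and s' = equivariant_endoD[OF scalar_equivariant[OF s]]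
  have "(\<lambda>x. r x \<otimes> s x) \<in> equivariant_endo"
    unfolding equivariant_endo_def
  proof (intro CollectI conjI ballI)
    show "(\<lambda>x. r x \<otimes> s x) \<in> A \<rightarrow> A" using r' s' by auto
    show "r (x \<otimes> y) \<otimes> s (x \<otimes> y) = r x \<otimes> s x \<otimes> (r y \<otimes> s y)" if "x \<in> A" "y \<in> A" for x y
      using that r' s' by (simp add: kernel_mult_swap)
    show "r (conj g x) \<otimes> s (conj g x) = conj g (r x \<otimes> s x)"
      if "g \<in> carrier G" "x \<in> A" for g x
      using that r' s' by (simp add: conj_mult)
  qed
  moreover have "r (q x) \<otimes> s (q x) = q (r x \<otimes> s x)" if "q \<in> equivariant_endo" "x \<in> A" for q x
    using that r' s' by (simp add: scalar_central[OF r] scalar_central[OF s] equivariant_endoD(2))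
  ultimately show ?thesis by (simp add: scalar_def)
qed

lemma inv_scalar:
  assumes r: "r \<in> scalar"
  shows "(\<lambda>x. inv (r x)) \<in> scalar"
proof -
  note r' = equivariant_endoD[OF scalar_equivariant[OF r]]
  have "(\<lambda>x. inv (r x)) \<in> equivariant_endo"
    unfolding equivariant_endo_def
  proof (intro CollectI conjI ballI)
    show "(\<lambda>x. inv (r x)) \<in> A \<rightarrow> A" using r' by auto
    show "inv (r (x \<otimes> y)) = inv (r x) \<otimes> inv (r y)" if "x \<in> A" "y \<in> A" for x y
      using that r' kernel_comm by (simp add: inv_mult_group)
    show "inv (r (conj g x)) = conj g (inv (r x))" if "g \<in> carrier G" "x \<in> A" for g x
      using that r' by (simp add: conj_def inv_mult_group m_assoc)
  qed
  moreover have "inv (r (q x)) = q (inv (r x))" if "q \<in> equivariant_endo" "x \<in> A" for q x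
    using that r' by (simp add: scalar_central[OF r] equivariant_endo_inv)
  ultimately show ?thesis by (simp add: scalar_def)
qed

lemma conj_scalar:
  assumes r: "r \<in> scalar" and g: "g \<in> carrier G"
  shows "(\<lambda>x. conj g (r x)) \<in> scalar"
proof -
  note r' = equivariant_endoD[OF scalar_equivariant[OF r]]
  have "(\<lambda>x. conj g (r x)) \<in> equivariant_endo"
    unfolding equivariant_endo_def
  proof (intro CollectI conjI ballI)
    show "(\<lambda>x. conj g (r x)) \<in> A \<rightarrow> A" using r' g conj_mem by auto
    show "conj g (r (x \<otimes> y)) = conj g (r x) \<otimes> conj g (r y)" if "x \<in> A" "y \<in> A" for x y
      using that r' g by (simp add: conj_mult)
    show "conj g (r (conj h x)) = conj h (conj g (r x))" if "h \<in> carrier G" "x \<in> A" for h x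
      using that r' g by (simp add: conj_commute)
  qed
  moreover have "conj g (r (q x)) = q (conj g (r x))" if "q \<in> equivariant_endo" "x \<in> A" for q x
    using that r' g by (simp add: scalar_central[OF r] equivariant_endoD(3))
  ultimately show ?thesis by (simp add: scalar_def)
qed

text \<open>The multiples of \<open>a\<close> by scalars form a normal subgroup that contains \<open>a\<close>, so a normal
  automorphism cannot take \<open>a\<close> out of it. The scalar may depend on \<open>a\<close>.\<close>

lemma normal_auto_scalar_multiple:
  assumes f: "f \<in> normal_auto G" and a: "a \<in> A"
  shows "\<exists>r\<in>scalar. f a = r a"
proof -
  let ?M = "(\<lambda>r. r a) ` scalar"
  have "subgroup ?M G"
  proof (rule subgroupI)
    show "?M \<subseteq> carrier G" using a equivariant_endoD(1)[OF scalar_equivariant] by auto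
    show "?M \<noteq> {}" using id_scalar by blast
    show "inv x \<in> ?M" if "x \<in> ?M" for x using that inv_scalar by force
    show "x \<otimes> y \<in> ?M" if "x \<in> ?M" "y \<in> ?M" for x y using that mult_scalar by force
  qed
  moreover have "g \<otimes> x \<otimes> inv g \<in> ?M" if "g \<in> carrier G" "x \<in> ?M" for g x
    using that conj_scalar unfolding conj_def by force
  ultimately have "?M \<lhd> G" by (simp add: normal_inv_iff)
  moreover have "a \<in> ?M" using id_scalar by force
  ultimately have "f a \<in> ?M" using normal_auto_mem[OF f] by blast
  thus ?thesis by blast
qed

text \<open>Here \<open>f g\<close> and \<open>g\<close> lie in the same coset of \<open>A\<close> and hence act on \<open>A\<close> in the same way. For
  a normal automorphism that moves cosets of \<open>A\<close>, the restriction to \<open>A\<close> is only semilinear.\<close>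

lemma section_stabilizer_equivariant:
  assumes "f \<in> section_stabilizer (carrier G) A"
  shows "f \<in> equivariant_endo"
proof -
  have f: "f \<in> normal_auto G" and fx: "\<And>x. x \<in> carrier G \<Longrightarrow> A #> f x = A #> x"
    using assms by (auto simp: section_stabilizer_def)
  interpret f: group_hom G G f by (rule normal_auto_group_hom[OF f])
  note fA = normal_auto_mem[OF f A_normal]
  have "f (conj g x) = conj g (f x)" if g: "g \<in> carrier G" and x: "x \<in> A" for g x
  proof -
    have "f (conj g x) = conj (f g) (f x)" using g x by (simp add: conj_def)
    also have "\<dots> = conj g (f x)" using g x fx fA by (intro conj_coset_cong) auto
    finally show ?thesis .
  qed
  thus ?thesis using fA by (auto simp: equivariant_endo_def)
qed

text \<open>Both composites send \<open>a\<close> to the same product of two scalars, because \<open>f\<close> and \<open>g\<close> commute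
  with scalars and scalars commute with each other.\<close>

lemma section_stabilizer_commute_on_kernel:
  assumes f: "f \<in> section_stabilizer (carrier G) A" and g: "g \<in> section_stabilizer (carrier G) A"
    and a: "a \<in> A"
  shows "f (g a) = g (f a)"
proof -
  have fe: "f \<in> equivariant_endo" and ge: "g \<in> equivariant_endo"
    using f g section_stabilizer_equivariant by auto
  have "f \<in> normal_auto G" "g \<in> normal_auto G" using f g by (auto simp: section_stabilizer_def)
  then obtain r s where r: "r \<in> scalar" "f a = r a" and s: "s \<in> scalar" "g a = s a"
    using normal_auto_scalar_multiple[OF _ a] by meson
  have "f (g a) = s (r a)" using scalar_central[OF s(1) fe a] r(2) s(2) by simp
  also have "\<dots> = r (s a)" by (rule scalar_central[OF s(1) scalar_equivariant[OF r(1)] a])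
  also have "\<dots> = g (f a)" using scalar_central[OF r(1) ge a] r(2) s(2) by simp
  finally show ?thesis .
qed

subsection \<open>Automorphisms trivial on the kernel and on the quotient\<close>

text \<open>Each of the two maps multiplies \<open>x\<close> by an element of \<open>A\<close>, which the other one fixes; these
  two factors commute.\<close>

lemma section_stabilizers_commute:
  assumes f: "f \<in> section_stabilizer (carrier G) A" "f \<in> section_stabilizer A {\<one>}"
    and g: "g \<in> section_stabilizer (carrier G) A" "g \<in> section_stabilizer A {\<one>}"
    and x: "x \<in> carrier G"
  shows "f (g x) = g (f x)"
proof -
  have fix_kernel: "u a = a" if "u \<in> section_stabilizer A {\<one>}" "a \<in> A" for u a
  proof -
    have "{\<one>} #> u a = {\<one>} #> a" "u a \<in> A"
      using that normal_auto_mem[OF _ A_normal] by (auto simp: section_stabilizer_def)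
    thus ?thesis using that(2) by (simp add: trivial_coset)
  qed
  have translate: "\<exists>d\<in>A. u x = d \<otimes> x" if "u \<in> section_stabilizer (carrier G) A" for u
    using that x normal_auto_closed by (intro coset_eq_imp_mult) (auto simp: section_stabilizer_def)
  obtain d e where d: "d \<in> A" "f x = d \<otimes> x" and e: "e \<in> A" "g x = e \<otimes> x"
    using translate f(1) g(1) by meson
  interpret f: group_hom G G f
    using f(1) by (intro normal_auto_group_hom) (simp add: section_stabilizer_def)
  interpret g: group_hom G G g
    using g(1) by (intro normal_auto_group_hom) (simp add: section_stabilizer_def)
  have "f (g x) = (e \<otimes> d) \<otimes> x" using d e x fix_kernel[OF f(2)] by (simp add: m_assoc)
  also have "e \<otimes> d = d \<otimes> e" using d e by (intro kernel_comm)
  also have "(d \<otimes> e) \<otimes> x = g (f x)" using d e x fix_kernel[OF g(2)] by (simp add: m_assoc)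
  finally show ?thesis .
qed

theorem third_derived_NormalAutoGroup:
  "(derived (NormalAutoGroup G) ^^ 3) (carrier (NormalAutoGroup G)) = {\<one>\<^bsub>NormalAutoGroup G\<^esub>}"
proof -
  interpret N: group "NormalAutoGroup G" by (rule group_NormalAutoGroup)
  let ?D = "derived (NormalAutoGroup G)" and ?C = "carrier (NormalAutoGroup G)"
  let ?K = "section_stabilizer (carrier G) A" and ?L = "section_stabilizer A {\<one>}"
  have triv: "{\<one>} \<lhd> G" by (rule one_is_normal)
  have K: "subgroup ?K (NormalAutoGroup G)"
    by (rule subgroup_section_stabilizer[OF normal_self A_normal])
  have KN: "?K \<subseteq> normal_auto G" by (auto simp: section_stabilizer_def)
  have D1: "?D ?C \<subseteq> ?K"
    using normal_autos_commute_mod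
    by (intro derived_subset_section_stabilizer normal_self A_normal) (auto simp: carrier_NormalAutoGroup)
  have D2: "?D ?K \<subseteq> ?K \<inter> ?L"
  proof (rule Int_greatest)
    show "?D ?K \<subseteq> ?K" by (rule N.derived_incl[OF subset_refl K])
    show "?D ?K \<subseteq> ?L"
      using section_stabilizer_commute_on_kernel
      by (intro derived_subset_section_stabilizer A_normal triv KN) simp
  qed
  have D3: "?D (?K \<inter> ?L) \<subseteq> section_stabilizer (carrier G) {\<one>}"
    using KN section_stabilizers_commute
    by (intro derived_subset_section_stabilizer normal_self triv) auto
  have "(?D ^^ 3) ?C = ?D (?D (?D ?C))" by (simp add: numeral_3_eq_3)
  also have "\<dots> \<subseteq> ?D (?D ?K)" by (intro N.mono_derived D1)
  also have "\<dots> \<subseteq> ?D (?K \<inter> ?L)" by (intro N.mono_derived D2)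
  also have "\<dots> \<subseteq> {\<one>\<^bsub>NormalAutoGroup G\<^esub>}"
    using D3 section_stabilizer_carrier_trivial by blast
  finally have "(?D ^^ 3) ?C \<subseteq> {\<one>\<^bsub>NormalAutoGroup G\<^esub>}" .
  moreover have "\<one>\<^bsub>NormalAutoGroup G\<^esub> \<in> (?D ^^ 3) ?C"
    by (rule subgroup.one_closed[OF N.exp_of_derived_is_subgroup[OF N.subgroup_self]])
  ultimately show ?thesis by blast
qed

end

section \<open>Metabelian groups\<close>

lemma (in group) metabelian_imp_abelian_by_abelian:
  assumes "metabelian G"
  shows "abelian_by_abelian (derived G (carrier G)) G"
proof -
  let ?A = "derived G (carrier G)"
  interpret A: normal ?A G by (rule derived_self_is_normal)
  have "derived G ?A = {\<one>}"
    using assms[unfolded metabelian_def solvable_derived_length_le_iff] by (simp add: numeral_2_eq_2)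
  moreover have "derived_set G ?A \<subseteq> derived G ?A"
    unfolding derived_def[of G ?A] by (rule subsetI) (rule generate.incl)
  ultimately have com: "derived_set G ?A \<subseteq> {\<one>}" by (simp only:)
  show ?thesis
  proof unfold_locales
    fix a b assume ab: "a \<in> ?A" "b \<in> ?A"
    have "a \<otimes> b \<otimes> inv a \<otimes> inv b = \<one>" using com ab by blast
    hence "a \<otimes> b \<otimes> inv (b \<otimes> a) = \<one>" using ab by (simp add: inv_mult_group m_assoc)
    hence "inv (inv (b \<otimes> a)) = a \<otimes> b" using ab by (intro inv_equality) auto
    thus "a \<otimes> b = b \<otimes> a" using ab by simp
  next
    fix x y assume xy: "x \<in> carrier G" "y \<in> carrier G"
    interpret Q: comm_group "G Mod ?A" by (rule derived_quot_is_comm_group)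
    have "?A #> x \<in> carrier (G Mod ?A)" "?A #> y \<in> carrier (G Mod ?A)"
      using A.r_coset_hom_Mod xy by (auto simp: hom_def)
    hence "(?A #> x) \<otimes>\<^bsub>G Mod ?A\<^esub> (?A #> y) = (?A #> y) \<otimes>\<^bsub>G Mod ?A\<^esub> (?A #> x)"
      by (rule Q.m_comm)
    thus "?A #> (x \<otimes> y) = ?A #> (y \<otimes> x)"
      using xy by (simp add: FactGroup_def A.rcos_sum)
  qed
qed

theorem corollary1:
  fixes G (structure)
  assumes "group G" and "metabelian G"
  shows "solvable (NormalAutoGroup G) \<and> derived_length (NormalAutoGroup G) \<le> 3"
proof -
  interpret group G by fact
  interpret abelian_by_abelian "derived G (carrier G)" G
    by (rule metabelian_imp_abelian_by_abelian[OF assms(2)])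
  show ?thesis
    using third_derived_NormalAutoGroup
      group.solvable_derived_length_le_iff[OF group_NormalAutoGroup] by blast
qed

end
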